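(* Let $N\ge2$, let $\Sigma\subset\mathbb{C}^N$ be compact, and let $k$ be an integer with $2\le k\le N$. If $K\subset\widehat{\Sigma}^{\,k}$ is a compact rationally convex set, then there is a compact subset $X$ of $\Sigma$ such that $h_r^{k-1}(X)\supset K$ and the set $h_r(X)\setminus K$ contains no analytic discs.
   Context: Let $X\subset\mathbb{C}^N$ be compact. An analytic subvariety of $\mathbb{C}^N$ of pure codimension $m$ means a pure-dimensional analytic subvariety of $\mathbb{C}^N$ of dimension $N-m$. The polynomial hull is $\widehat{X}=\{z: |p(z)|\le\max_X|p| \text{ for all polynomials } p\}$. For $1\le k\le N$, the $k$-rational hull $h_r^k(X)$ is the set of $z\in\mathbb{C}^N$ such that every analytic subvariety of $\mathbb{C}^N$ of pure codimension $\le k$ that passes through $z$ intersects $X$; $h_r(X)=h_r^1(X)$ is the usual rational hull $\{z: p(z)\in p(X) \text{ for all polynomials } p\}$, and $X$ is rationally convex if $h_r(X)=X$. For $2\le k\le N$ the $k$-polynomial hull $\widehat{X}^{\,k}$ is the set of $z\in\mathbb{C}^N$ such that $z\in h_r^{k-1}(X)$ and $z\in\widehat{X\cap V}$ for every analytic subvariety $V$ of $\mathbb{C}^N$ of pure codimension $\le k-1$ passing through $z$. An analytic disc is an injective holomorphic map $\sigma:D\to\mathbb{C}^N$ ($D$ the open unit disc); a set contains no analytic discs if no analytic disc has image in it. *)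

theory Defs
  imports "HOL-Analysis.Analysis"
begin

definition mpoly_fun :: "(complex^'n \<Rightarrow> complex) \<Rightarrow> bool" where
  "mpoly_fun p \<longleftrightarrow> (\<exists>(A :: ('n \<Rightarrow> nat) set) (c :: ('n \<Rightarrow> nat) \<Rightarrow> complex).
      finite A \<and> p = (\<lambda>z. \<Sum>\<alpha>\<in>A. c \<alpha> * (\<Prod>i\<in>UNIV. (z $ i) ^ (\<alpha> i))))"

definition poly_hull :: "(complex^'n) set \<Rightarrow> (complex^'n) set" where
  "poly_hull X = {z. \<forall>p. mpoly_fun p \<longrightarrow> (\<exists>x\<in>X. norm (p z) \<le> norm (p x))}"

definition rat_hull :: "(complex^'n) set \<Rightarrow> (complex^'n) set" where
  "rat_hull X = {z. \<forall>p. mpoly_fun p \<longrightarrow> p z \<in> p ` X}"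

definition rationally_convex :: "(complex^'n) set \<Rightarrow> bool" where
  "rationally_convex X \<longleftrightarrow> rat_hull X = X"

definition cholo_on :: "(complex^'n) set \<Rightarrow> (complex^'n \<Rightarrow> complex) \<Rightarrow> bool" where
  "cholo_on U f \<longleftrightarrow> (\<forall>z\<in>U. \<exists>L. (f has_derivative L) (at z) \<and>
       (\<forall>(c::complex) v. L (c *s v) = c * L v))"

definition analytic_subvariety :: "(complex^'n) set \<Rightarrow> bool" where
  "analytic_subvariety V \<longleftrightarrow> closed V \<and>
     (\<forall>a\<in>V. \<exists>U F. open U \<and> a \<in> U \<and> finite F \<and> (\<forall>f\<in>F. cholo_on U f) \<and>
        V \<inter> U = {z\<in>U. \<forall>f\<in>F. f z = 0})"

definition regular_point_codim :: "(complex^'n) set \<Rightarrow> nat \<Rightarrow> complex^'n \<Rightarrow> bool" where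
  "regular_point_codim V c a \<longleftrightarrow> a \<in> V \<and>
     (\<exists>U (f :: nat \<Rightarrow> complex^'n \<Rightarrow> complex). open U \<and> a \<in> U \<and>
        (\<forall>j<c. cholo_on U (f j)) \<and>
        V \<inter> U = {z\<in>U. \<forall>j<c. f j z = 0} \<and>
        (\<forall>z\<in>U. \<forall>\<mu> :: nat \<Rightarrow> complex.
           (\<forall>v. (\<Sum>j<c. \<mu> j * frechet_derivative (f j) (at z) v) = 0) \<longrightarrow> (\<forall>j<c. \<mu> j = 0)))"

text \<open>Analytic subvariety of pure codimension m (pure dimension N - m): every regular
  point has codimension m (regular points are dense in any analytic subvariety).\<close>
definition pure_codim :: "nat \<Rightarrow> (complex^'n) set \<Rightarrow> bool" where
  "pure_codim m V \<longleftrightarrow> analytic_subvariety V \<and>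
     (\<forall>a c. regular_point_codim V c a \<longrightarrow> c = m)"

definition rhull_k :: "nat \<Rightarrow> (complex^'n) set \<Rightarrow> (complex^'n) set" where
  "rhull_k k X = {z. \<forall>V m. m \<le> k \<and> pure_codim m V \<and> z \<in> V \<longrightarrow> V \<inter> X \<noteq> {}}"

text \<open>k-polynomial hull (for k \<ge> 2).\<close>
definition phull_k :: "nat \<Rightarrow> (complex^'n) set \<Rightarrow> (complex^'n) set" where
  "phull_k k X = {z. z \<in> rhull_k (k - 1) X \<and>
     (\<forall>V m. m \<le> k - 1 \<and> pure_codim m V \<and> z \<in> V \<longrightarrow> z \<in> poly_hull (X \<inter> V))}"

definition analytic_disc :: "(complex \<Rightarrow> complex^'n) \<Rightarrow> bool" where
  "analytic_disc \<sigma> \<longleftrightarrow> inj_on \<sigma> (ball 0 1) \<and>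
     (\<forall>i. (\<lambda>w. \<sigma> w $ i) holomorphic_on ball 0 1)"

definition contains_no_discs :: "(complex^'n) set \<Rightarrow> bool" where
  "contains_no_discs S \<longleftrightarrow> \<not> (\<exists>\<sigma>. analytic_disc \<sigma> \<and> \<sigma> ` ball 0 1 \<subseteq> S)"

end

theory Submission
  imports Defs "HOL-Complex_Analysis.Great_Picard"
begin

text \<open>Let \<open>g\<^sub>0, g\<^sub>1, \<dots>\<close> be a countable dense family of the polynomials without zeros on \<open>K\<close>,
  scaled so that \<open>\<bar>g\<^sub>j\<bar> \<le> 1\<close> on \<open>\<Sigma>\<close>, and let \<open>X\<close> be the set of \<open>x \<in> \<Sigma>\<close> with
  \<open>\<bar>g\<^sub>j x\<bar> \<ge> \<epsilon>\<^sub>j\<close> for all \<open>j\<close>.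
  No \<open>g\<^sub>j\<close> vanishes on the rational hull of \<open>X\<close>. If that hull contained an analytic disc
  outside \<open>K\<close>, rational convexity of \<open>K\<close> would give a polynomial without zeros on \<open>K\<close>
  that has an isolated zero on the disc, and by Hurwitz so would some \<open>g\<^sub>j\<close>.
  If \<open>V\<close> is a variety through \<open>z \<in> K\<close>, then \<open>z\<close> lies in the polynomial hull of \<open>\<Sigma> \<inter> V\<close>.
  Testing this on monomials in \<open>g\<^sub>0, \<dots>, g\<^sub>n\<close> with suitably weighted exponents yields points of
  \<open>\<Sigma> \<inter> V\<close> at which the first \<open>n\<close> constraints hold, and compactness gives a point of
  \<open>X \<inter> V\<close>.\<close>

section \<open>Closure properties and compactness bounds for polynomial functions\<close>

lemma mpoly_fun_monom: "mpoly_fun (\<lambda>z. c * (\<Prod>i\<in>UNIV. (z $ i) ^ \<alpha> i))"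
  unfolding mpoly_fun_def
  by (intro exI[of _ "{\<alpha>}"] exI[of _ "\<lambda>_. c"]) auto

lemma mpoly_fun_add:
  fixes p q :: "complex^'n \<Rightarrow> complex"
  assumes "mpoly_fun p" "mpoly_fun q"
  shows "mpoly_fun (\<lambda>z. p z + q z)"
proof -
  obtain A c where A: "finite A" "p = (\<lambda>z. \<Sum>\<alpha>\<in>A. c \<alpha> * (\<Prod>i\<in>UNIV. (z $ i) ^ (\<alpha> i)))"
    using assms(1) unfolding mpoly_fun_def by blast
  obtain B d where B: "finite B" "q = (\<lambda>z. \<Sum>\<alpha>\<in>B. d \<alpha> * (\<Prod>i\<in>UNIV. (z $ i) ^ (\<alpha> i)))"
    using assms(2) unfolding mpoly_fun_def by blast
  \<comment> \<open>Extending both coefficient families by zero lets the two sums run over the same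
    exponent set.\<close>
  define e where "e \<alpha> = (if \<alpha> \<in> A then c \<alpha> else 0) + (if \<alpha> \<in> B then d \<alpha> else 0)" for \<alpha>
  have "p z + q z = (\<Sum>\<alpha>\<in>A \<union> B. e \<alpha> * (\<Prod>i\<in>UNIV. (z $ i) ^ (\<alpha> i)))" for z
  proof -
    have "p z = (\<Sum>\<alpha>\<in>A \<union> B. (if \<alpha> \<in> A then c \<alpha> else 0) * (\<Prod>i\<in>UNIV. (z $ i) ^ (\<alpha> i)))"
      unfolding A(2) using A(1) B(1) by (intro sum.mono_neutral_cong_left) auto
    moreover have "q z = (\<Sum>\<alpha>\<in>A \<union> B. (if \<alpha> \<in> B then d \<alpha> else 0) * (\<Prod>i\<in>UNIV. (z $ i) ^ (\<alpha> i)))"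
      unfolding B(2) using A(1) B(1) by (intro sum.mono_neutral_cong_left) auto
    ultimately show ?thesis
      by (simp add: e_def distrib_right sum.distrib)
  qed
  then show ?thesis
    unfolding mpoly_fun_def using A(1) B(1)
    by (intro exI[of _ "A \<union> B"] exI[of _ e]) auto
qed

lemma mpoly_fun_const: "mpoly_fun (\<lambda>z. c)"
  using mpoly_fun_monom[of c "\<lambda>_. 0"] by simp

lemma mpoly_fun_sum:
  assumes "\<And>x. x \<in> A \<Longrightarrow> mpoly_fun (f x)"
  shows "mpoly_fun (\<lambda>z. \<Sum>x\<in>A. f x z)"
  using assms
  by (induction A rule: infinite_finite_induct) (auto intro: mpoly_fun_add mpoly_fun_const)

lemma mpoly_fun_mult:
  fixes p q :: "complex^'n \<Rightarrow> complex"
  assumes "mpoly_fun p" "mpoly_fun q"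
  shows "mpoly_fun (\<lambda>z. p z * q z)"
proof -
  obtain A c where A: "finite A" "p = (\<lambda>z. \<Sum>\<alpha>\<in>A. c \<alpha> * (\<Prod>i\<in>UNIV. (z $ i) ^ (\<alpha> i)))"
    using assms(1) unfolding mpoly_fun_def by blast
  obtain B d where B: "finite B" "q = (\<lambda>z. \<Sum>\<alpha>\<in>B. d \<alpha> * (\<Prod>i\<in>UNIV. (z $ i) ^ (\<alpha> i)))"
    using assms(2) unfolding mpoly_fun_def by blast
  have pq: "p z * q z = (\<Sum>\<alpha>\<in>A. \<Sum>\<beta>\<in>B. (c \<alpha> * d \<beta>) * (\<Prod>i\<in>UNIV. (z $ i) ^ (\<alpha> i + \<beta> i)))" for z
    unfolding A(2) B(2) sum_product by (simp add: power_add prod.distrib mult_ac)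
  show ?thesis
    unfolding pq by (intro mpoly_fun_sum mpoly_fun_monom)
qed

lemma mpoly_fun_power: "mpoly_fun p \<Longrightarrow> mpoly_fun (\<lambda>z. p z ^ m)"
  by (induction m) (auto intro: mpoly_fun_mult mpoly_fun_const)

lemma mpoly_fun_prod:
  assumes "\<And>x. x \<in> A \<Longrightarrow> mpoly_fun (f x)"
  shows "mpoly_fun (\<lambda>z. \<Prod>x\<in>A. f x z)"
  using assms
  by (induction A rule: infinite_finite_induct) (auto intro: mpoly_fun_mult mpoly_fun_const)

lemma mpoly_fun_coord: "mpoly_fun (\<lambda>z :: complex^'n. z $ i)"
proof -
  have "(\<Prod>j\<in>UNIV. (z $ j) ^ (if j = i then 1 else 0)) = z $ i" for z :: "complex^'n"
  proof -
    have "(\<Prod>j\<in>UNIV. (z $ j) ^ (if j = i then 1 else 0)) = (\<Prod>j\<in>UNIV. if j = i then z $ j else 1)"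
      by (intro prod.cong) auto
    then show ?thesis by simp
  qed
  then show ?thesis
    using mpoly_fun_monom[of 1 "\<lambda>j. if j = i then 1 else 0"] by simp
qed

lemma continuous_on_mpoly_fun:
  assumes "mpoly_fun p"
  shows "continuous_on S p"
  using assms unfolding mpoly_fun_def by (auto intro!: continuous_intros)

lemma holomorphic_on_mpoly_fun_comp:
  assumes "mpoly_fun p" "\<And>i. (\<lambda>w. \<sigma> w $ i) holomorphic_on S"
  shows "(\<lambda>w. p (\<sigma> w)) holomorphic_on S"
  using assms unfolding mpoly_fun_def by (auto intro!: holomorphic_intros)

lemma bounded_mpoly_fun_image:
  assumes "mpoly_fun p" "compact S"
  obtains b where "b > 0" "\<And>z. z \<in> S \<Longrightarrow> norm (p z) \<le> b"
  using compact_imp_bounded[OF compact_continuous_image[OF continuous_on_mpoly_fun[OF assms(1)] assms(2)]]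
  unfolding bounded_pos by auto

lemma mpoly_fun_bounded_below:
  assumes "mpoly_fun p" "compact S" "\<And>z. z \<in> S \<Longrightarrow> p z \<noteq> 0"
  obtains \<delta> where "\<delta> > 0" "\<And>z. z \<in> S \<Longrightarrow> \<delta> \<le> norm (p z)"
proof (cases "S = {}")
  case True
  then show ?thesis using that[of 1] by simp
next
  case False
  have "continuous_on S (\<lambda>z. norm (p z))"
    by (intro continuous_intros continuous_on_mpoly_fun assms)
  from continuous_attains_inf[OF assms(2) False this]
  obtain y where "y \<in> S" "\<And>z. z \<in> S \<Longrightarrow> norm (p y) \<le> norm (p z)" by auto
  then show ?thesis using that[of "norm (p y)"] assms(3) by auto
qed

text \<open>Polynomials with coefficients in a countable dense subset of the plane suffice: on a
  compact set each monomial is bounded, so small changes of finitely many coefficients change the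
  value little. The family is fixed before the compact set is chosen.\<close>

lemma countable_dense_mpoly_funs:
  obtains P :: "(complex^'n \<Rightarrow> complex) set"
  where "countable P" "\<And>p. p \<in> P \<Longrightarrow> mpoly_fun p"
    "\<And>p S \<epsilon>. mpoly_fun p \<Longrightarrow> compact S \<Longrightarrow> \<epsilon> > 0 \<Longrightarrow> \<exists>q\<in>P. \<forall>z\<in>S. norm (q z - p z) < \<epsilon>"
proof -
  obtain D :: "complex set"
    where D: "countable D" "\<And>X. open X \<Longrightarrow> X \<noteq> {} \<Longrightarrow> \<exists>d\<in>D. d \<in> X"
    using countable_dense_setE by blast
  define ev where "ev A c = (\<lambda>z :: complex^'n. \<Sum>\<alpha>\<in>A. c \<alpha> * (\<Prod>i\<in>UNIV. (z $ i) ^ (\<alpha> i)))"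
    for A :: "('n \<Rightarrow> nat) set" and c
  \<comment> \<open>\<open>PiE\<close> fixes the coefficients off the finite set \<open>A\<close>,
    which keeps the choices countable.\<close>
  define P where "P = (\<Union>A\<in>Collect finite. ev A ` (PiE A (\<lambda>_. D)))"
  have "countable P"
    unfolding P_def using D(1)
    by (intro countable_UN countable_Collect_finite countable_image countable_PiE) auto
  moreover have "mpoly_fun p" if "p \<in> P" for p
    using that unfolding P_def ev_def mpoly_fun_def by blast
  moreover have "\<exists>q\<in>P. \<forall>z\<in>S. norm (q z - p z) < \<epsilon>"
    if p: "mpoly_fun p" and S: "compact S" and \<epsilon>: "\<epsilon> > 0" for p S and \<epsilon> :: real
  proof -
    obtain A c where A: "finite A" "p = ev A c"
      using p unfolding mpoly_fun_def ev_def by blast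
    have "\<exists>b>0. \<forall>z\<in>S. norm (\<Prod>i\<in>UNIV. (z $ i) ^ (\<alpha> i)) \<le> b" for \<alpha>
      using bounded_mpoly_fun_image[OF mpoly_fun_monom[of 1 \<alpha>] S] by (metis mult_1)
    then obtain b where b: "\<And>\<alpha>. b \<alpha> > 0"
      "\<And>\<alpha> z. z \<in> S \<Longrightarrow> norm (\<Prod>i\<in>UNIV. (z $ i) ^ (\<alpha> i)) \<le> b \<alpha>" by metis
    \<comment> \<open>The summand 1 makes \<open>B\<close> positive even for empty \<open>A\<close>
      and the comparison strict, so coefficient errors below \<open>\<epsilon> / B\<close> add up to
      less than \<open>\<epsilon>\<close>.\<close>
    define B where "B = 1 + (\<Sum>\<alpha>\<in>A. b \<alpha>)"
    have B: "B > 0" "(\<Sum>\<alpha>\<in>A. b \<alpha>) < B"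
      using sum_nonneg[of A b] b(1) by (auto simp: B_def less_imp_le add_pos_nonneg)
    have "\<epsilon> / B > 0" using \<epsilon> B by simp
    then have "\<exists>d\<in>D. norm (d - c \<alpha>) < \<epsilon> / B" for \<alpha>
      using D(2)[of "ball (c \<alpha>) (\<epsilon> / B)"] by (auto simp: dist_norm norm_minus_commute)
    then obtain d where d: "\<And>\<alpha>. d \<alpha> \<in> D" "\<And>\<alpha>. norm (d \<alpha> - c \<alpha>) < \<epsilon> / B" by metis
    have "ev A (restrict d A) \<in> P"
      unfolding P_def using A(1) d(1) by auto
    moreover have "norm (ev A (restrict d A) z - p z) < \<epsilon>" if z: "z \<in> S" for z
    proof -
      have "ev A (restrict d A) z - p z = (\<Sum>\<alpha>\<in>A. (d \<alpha> - c \<alpha>) * (\<Prod>i\<in>UNIV. (z $ i) ^ (\<alpha> i)))"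
        unfolding A(2) ev_def sum_subtractf[symmetric]
        by (intro sum.cong) (auto simp: algebra_simps)
      also have "norm \<dots> \<le> (\<Sum>\<alpha>\<in>A. \<epsilon> / B * b \<alpha>)"
      proof (rule sum_norm_le)
        show "norm ((d \<alpha> - c \<alpha>) * (\<Prod>i\<in>UNIV. (z $ i) ^ (\<alpha> i))) \<le> \<epsilon> / B * b \<alpha>" for \<alpha>
          unfolding norm_mult
          using less_imp_le[OF d(2)] b(2)[OF z] \<open>\<epsilon> / B > 0\<close> by (intro mult_mono) auto
      qed
      also have "\<dots> = \<epsilon> * ((\<Sum>\<alpha>\<in>A. b \<alpha>) / B)"
        unfolding sum_distrib_left[symmetric] by simp
      also have "\<dots> < \<epsilon> * 1"
        using \<epsilon> B by (intro mult_strict_left_mono) auto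
      finally show ?thesis by simp
    qed
    ultimately show ?thesis by blast
  qed
  ultimately show ?thesis by (rule that)
qed

section \<open>Simultaneous lower bounds from the polynomial hull\<close>

lemma sum_inverse_power_two_le_1: "(\<Sum>i<n. 1 / 2 ^ Suc i :: real) \<le> 1"
proof -
  have "(\<Sum>i<n. 1 / 2 ^ Suc i :: real) = 1 - 1 / 2 ^ n"
    by (induction n) (auto simp: field_simps)
  then show ?thesis by simp
qed

text \<open>The threshold for \<open>g j\<close> does not depend on \<open>n\<close>. The test polynomial is
  \<open>\<Prod>i. g i ^ M i\<close> with \<open>M i\<close> proportional to \<open>1 / (2 ^ Suc i * L i)\<close>, so that the
  contributions of the \<open>g i\<close> to \<open>- log\<^sub>2\<close> of its modulus at \<open>z\<close> form a geometric series.\<close>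

lemma poly_hull_simultaneous_lower_bound:
  fixes g :: "nat \<Rightarrow> complex^'n \<Rightarrow> complex" and L :: "nat \<Rightarrow> nat"
  assumes z: "z \<in> poly_hull Y"
    and g: "\<And>i. mpoly_fun (g i)" "\<And>i x. x \<in> Y \<Longrightarrow> norm (g i x) \<le> 1"
    and L: "\<And>i. L i > 0" "\<And>i. (1/2) ^ L i \<le> norm (g i z)"
  shows "\<exists>x\<in>Y. \<forall>j<n. (1/2) ^ (2 ^ Suc j * L j) \<le> norm (g j x)"
proof -
  define w where "w j = 2 ^ Suc j * L j" for j
  \<comment> \<open>Clearing denominators: \<open>M i\<close> is the product of the other weights,
    hence an integer equal to \<open>W / w i\<close>.\<close>
  define W where "W = (\<Prod>j<n. w j)"
  define M where "M i = (\<Prod>j\<in>{..<n} - {i}. w j)" for i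
  have w: "w j > 0" for j by (simp add: w_def L)
  have M: "M i > 0" for i unfolding M_def using w by (simp add: prod_pos)
  have WM: "W = w i * M i" if "i < n" for i
    unfolding W_def M_def using that by (intro prod.remove) auto
  have "real (\<Sum>i<n. L i * M i) = (\<Sum>i<n. real W * (1 / 2 ^ Suc i))"
    unfolding of_nat_sum by (intro sum.cong) (auto simp: WM w_def)
  also have "\<dots> = real W * (\<Sum>i<n. 1 / 2 ^ Suc i)"
    by (simp only: sum_distrib_left)
  also have "\<dots> \<le> real W * 1"
    by (intro mult_left_mono sum_inverse_power_two_le_1) auto
  finally have le: "(\<Sum>i<n. L i * M i) \<le> W"
    unfolding mult_1_right of_nat_le_iff .
  have "mpoly_fun (\<lambda>x. \<Prod>i<n. g i x ^ M i)"
    by (intro mpoly_fun_prod mpoly_fun_power g)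
  then obtain x where x: "x \<in> Y"
    "norm (\<Prod>i<n. g i z ^ M i) \<le> norm (\<Prod>i<n. g i x ^ M i)"
    using z unfolding poly_hull_def by blast
  have "(1/2) ^ w j \<le> norm (g j x)" if j: "j < n" for j
  proof -
    have "((1/2) ^ w j) ^ M j = (1/2 :: real) ^ W"
      by (simp add: WM[OF j] power_mult)
    also have "\<dots> \<le> (1/2) ^ (\<Sum>i<n. L i * M i)"
      using le by (intro power_decreasing) auto
    also have "\<dots> = (\<Prod>i<n. ((1/2) ^ L i) ^ M i)"
      by (simp add: power_sum power_mult)
    also have "\<dots> \<le> (\<Prod>i<n. norm (g i z) ^ M i)"
      using L by (intro prod_mono) (auto intro!: power_mono)
    also have "\<dots> \<le> (\<Prod>i<n. norm (g i x) ^ M i)"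
      using x(2) by (simp add: prod_norm[symmetric] norm_power)
    also have "\<dots> = norm (g j x) ^ M j * (\<Prod>i\<in>{..<n} - {j}. norm (g i x) ^ M i)"
      using j by (intro prod.remove) auto
    \<comment> \<open>The other factors have modulus at most 1 on \<open>Y\<close>, so the bound for
      the whole product passes to the factor \<open>j\<close>; the \<open>M j\<close>-th root is
      then taken.\<close>
    also have "\<dots> \<le> norm (g j x) ^ M j * 1"
      using g(2)[OF x(1)] by (intro mult_left_mono prod_le_1) (auto intro: power_le_one)
    finally show ?thesis
      using M[of j] by (simp add: power_mono_iff)
  qed
  then show ?thesis using x(1) unfolding w_def by blast
qed

section \<open>Zeros of polynomials along analytic discs\<close>

text \<open>Rational convexity separates \<open>\<sigma> 0\<close> from \<open>K\<close> by a
  polynomial. Should it be constant along the disc, a small multiple of a coordinate difference is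
  added, which injectivity of \<open>\<sigma>\<close> makes nonconstant.\<close>

lemma nonvanishing_mpoly_fun_zero_on_disc:
  fixes \<sigma> :: "complex \<Rightarrow> complex^'n"
  assumes K: "compact K" "rationally_convex K"
    and \<sigma>: "analytic_disc \<sigma>" "\<sigma> 0 \<notin> K" and r: "0 < r" "r \<le> 1"
  obtains q where "mpoly_fun q" "\<And>z. z \<in> K \<Longrightarrow> q z \<noteq> 0" "q (\<sigma> 0) = 0"
    "\<not> (\<lambda>w. q (\<sigma> w)) constant_on ball 0 r"
proof -
  obtain p where p: "mpoly_fun p" "p (\<sigma> 0) \<notin> p ` K"
    using K(2) \<sigma>(2) unfolding rationally_convex_def rat_hull_def by blast
  define q where "q z = p z + - p (\<sigma> 0)" for z
  have q: "mpoly_fun q" "q (\<sigma> 0) = 0" "\<And>z. z \<in> K \<Longrightarrow> q z \<noteq> 0"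
    unfolding q_def[abs_def] using mpoly_fun_add[OF p(1) mpoly_fun_const[of "- p (\<sigma> 0)"]] p(2)
    by (simp_all add: image_iff) metis
  show ?thesis
  proof (cases "(\<lambda>w. q (\<sigma> w)) constant_on ball 0 r")
    case False
    then show ?thesis using that q by blast
  next
    case True
    then have q0: "q (\<sigma> w) = 0" if "w \<in> ball 0 r" for w
      using that q(2) r unfolding constant_on_def by (metis centre_in_ball)
    define w where "w = complex_of_real (r / 2)"
    have w: "w \<in> ball 0 r" "w \<noteq> 0" using r by (auto simp: w_def)
    then have "\<sigma> w \<noteq> \<sigma> 0"
      using \<sigma>(1) r unfolding analytic_disc_def by (auto dest!: inj_onD[where x = w and y = 0])
    then obtain i where i: "\<sigma> w $ i \<noteq> \<sigma> 0 $ i" by (auto simp: vec_eq_iff)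
    define l where "l z = z $ i + - \<sigma> 0 $ i" for z :: "complex^'n"
    have l: "mpoly_fun l" unfolding l_def[abs_def]
      by (intro mpoly_fun_add mpoly_fun_const mpoly_fun_coord)
    obtain \<delta> where \<delta>: "\<delta> > 0" "\<And>z. z \<in> K \<Longrightarrow> \<delta> \<le> norm (q z)"
      using mpoly_fun_bounded_below[OF q(1) K(1) q(3)] by blast
    obtain b where b: "b > 0" "\<And>z. z \<in> K \<Longrightarrow> norm (l z) \<le> b"
      using bounded_mpoly_fun_image[OF l K(1)] by blast
    \<comment> \<open>With this factor the perturbation is at most \<open>\<delta> / 2\<close> in
      modulus on \<open>K\<close>, too small to create a zero there.\<close>
    define \<eta> where "\<eta> = complex_of_real (\<delta> / (2 * b))"
    have \<eta>: "\<eta> \<noteq> 0" using \<delta> b by (simp add: \<eta>_def)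
    show ?thesis
    proof (rule that[of "\<lambda>z. q z + \<eta> * l z"])
      show "mpoly_fun (\<lambda>z. q z + \<eta> * l z)"
        by (intro mpoly_fun_add mpoly_fun_mult mpoly_fun_const q l)
      show "q (\<sigma> 0) + \<eta> * l (\<sigma> 0) = 0" by (simp add: q l_def)
      show "q z + \<eta> * l z \<noteq> 0" if "z \<in> K" for z
      proof
        assume "q z + \<eta> * l z = 0"
        then have "norm (q z) = norm \<eta> * norm (l z)"
          by (metis add_eq_0_iff norm_minus_cancel norm_mult)
        also have "\<dots> \<le> \<delta> / (2 * b) * b"
          using b(2)[OF that] \<delta> b(1) unfolding \<eta>_def norm_of_real
          by (intro mult_mono) auto
        also have "\<dots> < \<delta>" using \<delta> b by simp
        finally show False using \<delta>(2)[OF that] by simp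
      qed
      show "\<not> (\<lambda>w. q (\<sigma> w) + \<eta> * l (\<sigma> w)) constant_on ball 0 r"
      proof
        assume "(\<lambda>w. q (\<sigma> w) + \<eta> * l (\<sigma> w)) constant_on ball 0 r"
        then have "q (\<sigma> w) + \<eta> * l (\<sigma> w) = q (\<sigma> 0) + \<eta> * l (\<sigma> 0)"
          using w(1) r unfolding constant_on_def by (metis centre_in_ball)
        then show False using q0[OF w(1)] q(2) \<eta> i by (simp add: l_def)
      qed
    qed
  qed
qed

text \<open>Members of \<open>P\<close> close to a polynomial without zeros on \<open>K\<close> have
  no zeros on \<open>K\<close> either, hence none on \<open>E\<close>. By Hurwitz, their limit
  cannot have a zero on a disc in \<open>E\<close> along which it is nonconstant.\<close>

lemma no_discs_if_dense_mpoly_funs_nonvanishing: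
  fixes K E :: "(complex^'n) set"
  assumes K: "compact K" "rationally_convex K"
    and dense: "\<And>p S \<epsilon>. mpoly_fun p \<Longrightarrow> compact S \<Longrightarrow> \<epsilon> > 0 \<Longrightarrow> \<exists>q\<in>P. \<forall>z\<in>S. norm (q z - p z) < \<epsilon>"
    and P: "\<And>p. p \<in> P \<Longrightarrow> mpoly_fun p"
    and E: "\<And>p z. p \<in> P \<Longrightarrow> (\<And>x. x \<in> K \<Longrightarrow> p x \<noteq> 0) \<Longrightarrow> z \<in> E \<Longrightarrow> p z \<noteq> 0"
  shows "contains_no_discs (E - K)"
  unfolding contains_no_discs_def
proof safe
  fix \<sigma> :: "complex \<Rightarrow> complex^'n"
  assume \<sigma>: "analytic_disc \<sigma>" "\<sigma> ` ball 0 1 \<subseteq> E - K"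
  then have "\<sigma> 0 \<notin> K" by force
  then obtain q where q: "mpoly_fun q" "\<And>z. z \<in> K \<Longrightarrow> q z \<noteq> 0" "q (\<sigma> 0) = 0"
    "\<not> (\<lambda>w. q (\<sigma> w)) constant_on ball 0 (1/2)"
    using nonvanishing_mpoly_fun_zero_on_disc[OF K \<sigma>(1), of "1/2"] by auto
  obtain \<delta> where \<delta>: "\<delta> > 0" "\<And>z. z \<in> K \<Longrightarrow> \<delta> \<le> norm (q z)"
    using mpoly_fun_bounded_below[OF q(1) K(1) q(2)] by blast
  have hol: "(\<lambda>w. \<sigma> w $ i) holomorphic_on ball 0 1" for i
    using \<sigma>(1) by (simp add: analytic_disc_def)
  have "continuous_on (cball 0 (1/2)) (\<lambda>w. \<chi> i. \<sigma> w $ i)"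
    by (intro continuous_on_vec_lambda holomorphic_on_imp_continuous_on holomorphic_on_subset[OF hol]) auto
  then have "continuous_on (cball 0 (1/2)) \<sigma>" by simp
  \<comment> \<open>Radius 1/2 is used because the image of the closed smaller disc is compact, so
    approximation is uniform on it.\<close>
  then have S: "compact (K \<union> \<sigma> ` cball 0 (1/2))"
    using K(1) by (intro compact_Un compact_continuous_image) auto
  \<comment> \<open>The bound \<open>\<delta>\<close> keeps the approximants zero-free on
    \<open>K\<close>; the bound \<open>1 / Suc n\<close> forces convergence.\<close>
  have "\<exists>f\<in>P. \<forall>z\<in>K \<union> \<sigma> ` cball 0 (1/2). norm (f z - q z) < min \<delta> (1 / Suc n)" for n
    using \<delta>(1) by (intro dense q S) auto
  then obtain f where f: "\<And>n. f n \<in> P"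
    "\<And>n z. z \<in> K \<union> \<sigma> ` cball 0 (1/2) \<Longrightarrow> norm (f n z - q z) < min \<delta> (1 / Suc n)"
    by metis
  have fK: "f n z \<noteq> 0" if "z \<in> K" for n z
    using f(2)[of z n] \<delta>(2)[of z] that by auto
  have hol': "(\<lambda>w. \<sigma> w $ i) holomorphic_on ball 0 (1/2)" for i
    by (rule holomorphic_on_subset[OF hol]) auto
  have "q (\<sigma> 0) \<noteq> 0"
  proof (rule Hurwitz_no_zeros[of "ball 0 (1/2)" "\<lambda>n w. f n (\<sigma> w)" "\<lambda>w. q (\<sigma> w)"])
    show "(\<lambda>w. f n (\<sigma> w)) holomorphic_on ball 0 (1/2)" for n
      by (rule holomorphic_on_mpoly_fun_comp[OF P[OF f(1)] hol'])
    show "(\<lambda>w. q (\<sigma> w)) holomorphic_on ball 0 (1/2)"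
      by (rule holomorphic_on_mpoly_fun_comp[OF q(1) hol'])
    show "uniform_limit T (\<lambda>n w. f n (\<sigma> w)) (\<lambda>w. q (\<sigma> w)) sequentially"
      if T: "compact T" "T \<subseteq> ball 0 (1/2)" for T
    proof (rule uniform_limitI)
      fix e :: real assume "e > 0"
      then obtain N where N: "1 / Suc N < e" using nat_approx_posE by blast
      have "dist (f n (\<sigma> w)) (q (\<sigma> w)) < e" if "n \<ge> N" "w \<in> T" for n w
      proof -
        have "w \<in> cball 0 (1/2)" using that T by auto
        then have "dist (f n (\<sigma> w)) (q (\<sigma> w)) < 1 / Suc n"
          using f(2)[of "\<sigma> w" n] by (simp add: dist_norm)
        also have "\<dots> \<le> 1 / Suc N" using that by (simp add: frac_le)
        finally show ?thesis using N by simp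
      qed
      then show "\<forall>\<^sub>F n in sequentially. \<forall>w\<in>T. dist (f n (\<sigma> w)) (q (\<sigma> w)) < e"
        unfolding eventually_sequentially by blast
    qed
    show "f n (\<sigma> w) \<noteq> 0" if "w \<in> ball 0 (1/2)" for n w
    proof -
      have "w \<in> ball 0 1" using that by simp
      then have "\<sigma> w \<in> E" using \<sigma>(2) by blast
      then show ?thesis using E[OF f(1) fK] by blast
    qed
  qed (use q(4) in auto)
  with q(3) show False by simp
qed

section \<open>Construction of \<open>X\<close> from countably many constraints\<close>

theorem theorem5p5:
  fixes \<Sigma> K :: "(complex^'n) set" and k :: nat
  assumes "CARD('n) \<ge> 2"
    and "compact \<Sigma>"
    and "2 \<le> k" and "k \<le> CARD('n)"
    and "compact K" and "rationally_convex K"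
    and "K \<subseteq> phull_k k \<Sigma>"
  shows "\<exists>X. compact X \<and> X \<subseteq> \<Sigma> \<and> K \<subseteq> rhull_k (k - 1) X \<and>
           contains_no_discs (rat_hull X - K)"
proof -
  obtain P :: "(complex^'n \<Rightarrow> complex) set" where P: "countable P" "\<And>p. p \<in> P \<Longrightarrow> mpoly_fun p"
    and dense: "\<And>p S \<epsilon>. mpoly_fun p \<Longrightarrow> compact S \<Longrightarrow> \<epsilon> > 0 \<Longrightarrow> \<exists>q\<in>P. \<forall>z\<in>S. norm (q z - p z) < \<epsilon>"
    using countable_dense_mpoly_funs by metis
  \<comment> \<open>The constant 1 makes \<open>Q\<close> nonempty, as the enumeration by
    \<open>from_nat_into\<close> requires, and has no zeros on \<open>K\<close>.\<close>
  define Q where "Q = insert (\<lambda>_. 1) {p \<in> P. \<forall>z\<in>K. p z \<noteq> 0}"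
  have Q: "countable Q" "Q \<noteq> {}" using P(1) by (auto simp: Q_def)
  define p where "p = from_nat_into Q"
  have pQ: "p j \<in> Q" for j unfolding p_def using from_nat_into[OF Q(2)] .
  have p: "mpoly_fun (p j)" "z \<in> K \<Longrightarrow> p j z \<noteq> 0" for j z
    using pQ[of j] P(2)[of "p j"] mpoly_fun_const[of 1] by (auto simp: Q_def)
  have "\<exists>b>0. \<forall>z\<in>\<Sigma>. norm (p j z) \<le> b" for j
    using bounded_mpoly_fun_image[OF p(1) \<open>compact \<Sigma>\<close>] by metis
  then obtain b where b: "\<And>j. b j > 0" "\<And>j z. z \<in> \<Sigma> \<Longrightarrow> norm (p j z) \<le> b j" by metis
  define g where "g j z = of_real (1 / b j) * p j z" for j z
  have g: "mpoly_fun (g j)" "z \<in> K \<Longrightarrow> g j z \<noteq> 0" "g j z = 0 \<longleftrightarrow> p j z = 0" for j z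
    unfolding g_def[abs_def]
    using mpoly_fun_mult[OF mpoly_fun_const[of "of_real (1 / b j)"] p(1)[of j]] p(2) b(1)[of j]
    by auto
  have g1: "norm (g j z) \<le> 1" if "z \<in> \<Sigma>" for j z
    using b(1)[of j] b(2)[OF that, of j] by (simp add: g_def norm_mult norm_divide field_simps)
  \<comment> \<open>Compactness of \<open>K\<close> makes \<open>L\<close> uniform in
    \<open>z\<close>, so one set \<open>X\<close> can serve all points of \<open>K\<close>. Taking
    \<open>Suc L\<close> below ensures a positive exponent.\<close>
  have "\<exists>L>0. \<forall>z\<in>K. (1/2) ^ L \<le> norm (g j z)" for j
  proof -
    obtain \<delta> where \<delta>: "\<delta> > 0" "\<And>z. z \<in> K \<Longrightarrow> \<delta> \<le> norm (g j z)"
      using mpoly_fun_bounded_below[OF g(1) \<open>compact K\<close> g(2)] by blast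
    obtain L where "(1/2) ^ L < \<delta>" using real_arch_pow_inv[OF \<delta>(1), of "1/2"] by auto
    then have "(1/2) ^ Suc L \<le> \<delta>" by (simp add: field_simps)
    then show ?thesis using \<delta>(2) by (intro exI[of _ "Suc L"]) force
  qed
  then obtain L where L: "\<And>j. L j > 0" "\<And>j z. z \<in> K \<Longrightarrow> (1/2) ^ L j \<le> norm (g j z)" by metis
  \<comment> \<open>These are the thresholds of the hull estimate; they depend on neither the point
    of \<open>K\<close> nor the variety.\<close>
  define \<epsilon> :: "nat \<Rightarrow> real" where "\<epsilon> j = (1/2) ^ (2 ^ Suc j * L j)" for j
  define F where "F n = (\<Inter>j<n. {x. \<epsilon> j \<le> norm (g j x)})" for n
  define X where "X = \<Sigma> \<inter> (\<Inter>n. F n)"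
  have closed_F: "closed (F n)" for n
    unfolding F_def
    by (intro closed_INT ballI closed_Collect_le continuous_intros continuous_on_mpoly_fun g)
  have "compact X" unfolding X_def
    by (intro compact_Int_closed \<open>compact \<Sigma>\<close> closed_INT ballI closed_F)
  moreover have "X \<subseteq> \<Sigma>" by (auto simp: X_def)
  moreover have "K \<subseteq> rhull_k (k - 1) X"
    unfolding rhull_k_def
  proof safe
    fix z V m
    assume z: "z \<in> K" and V: "m \<le> k - 1" "pure_codim m V" "z \<in> V" and empty: "V \<inter> X = {}"
    have hull: "z \<in> poly_hull (\<Sigma> \<inter> V)"
      using assms(7) z V unfolding phull_k_def by blast
    have "closed V" using V(2) unfolding pure_codim_def analytic_subvariety_def by blast
    \<comment> \<open>Each finite set of constraints is satisfied somewhere on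
      \<open>\<Sigma> \<inter> V\<close>; nested nonempty compact sets then give a point satisfying
      all of them.\<close>
    have "(\<Inter>n. \<Sigma> \<inter> V \<inter> F n) \<noteq> {}"
    proof (rule compact_nest)
      show "compact (\<Sigma> \<inter> V \<inter> F n)" for n
        by (intro compact_Int_closed \<open>compact \<Sigma>\<close> \<open>closed V\<close> closed_F)
      show "\<Sigma> \<inter> V \<inter> F n \<noteq> {}" for n
        using poly_hull_simultaneous_lower_bound[where g = g and L = L and n = n, OF hull g(1) _ L(1) L(2)[OF z]] g1
        unfolding F_def \<epsilon>_def by auto
      show "\<Sigma> \<inter> V \<inter> F n \<subseteq> \<Sigma> \<inter> V \<inter> F m" if "m \<le> n" for m n
        using that unfolding F_def by auto
    qed
    with empty show False unfolding X_def by auto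
  qed
  moreover have "contains_no_discs (rat_hull X - K)"
  proof (rule no_discs_if_dense_mpoly_funs_nonvanishing[OF assms(5,6) dense P(2)])
    fix q z assume q: "q \<in> P" "\<And>x. x \<in> K \<Longrightarrow> q x \<noteq> 0" and z: "z \<in> rat_hull X"
    have "q \<in> Q" using q by (auto simp: Q_def)
    then obtain j where j: "q = p j"
      unfolding p_def using from_nat_into_surj[OF Q(1)] by metis
    \<comment> \<open>A polynomial without zeros on \<open>X\<close> has none on the rational hull,
      since its values there are already taken on \<open>X\<close>.\<close>
    have "p j x \<noteq> 0" if "x \<in> X" for x
    proof -
      have "x \<in> F (Suc j)" using that unfolding X_def by blast
      then have "\<epsilon> j \<le> norm (g j x)" unfolding F_def by blast
      moreover have "\<epsilon> j > 0" by (simp add: \<epsilon>_def)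
      ultimately show ?thesis using g(3)[of j x] by auto
    qed
    moreover have "p j z \<in> p j ` X" using z p(1) unfolding rat_hull_def by blast
    ultimately show "q z \<noteq> 0" using j by auto
  qed
  ultimately show ?thesis by blast
qed

end
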